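(* Let $m\in\mathbb N_{\ge1}$. There exists a number $N(m)\le(2m+1)\uparrow\uparrow5$ such that for every $\varepsilon>0$ there is no deterministic $(m-\varepsilon)$-competitive online algorithm for Online Makespan Hypergraph Coloring with $m$ colors, even when restricted to hyperforests with $N(m)$ nodes in which every hyperedge has at most $m$ nodes.
   Context: Online Makespan Hypergraph Coloring with $m$ colors: a hypergraph $\mathcal H=(V,E)$ with nodes $V=[n]$ is revealed online; nodes are revealed in the order $1,2,\dots,n$, and when node $j$ is revealed the algorithm learns the partial hyperedges $e\cap[j]$ for all $e\in E$, and must then irrevocably assign $j$ a color $c(j)\in[m]$. The objective (makespan) is $\max_{i\in[m]}\max_{e\in E}|c^{-1}(i)\cap e|$, to be minimized. A deterministic online algorithm is $r$-competitive if on every instance its objective value is at most $r$ times the minimum objective over all colorings $[n]\to[m]$. A hypercycle is a sequence $v_1,e_1,v_2,\dots,e_\ell,v_{\ell+1}=v_1$ with pairwise distinct hyperedges $e_t$ such that $v_t,v_{t+1}\in e_t$; a hyperforest is a hypergraph without hypercycle. Notation: $x\uparrow\uparrow5=x^{x^{x^{x^{x}}}}$ (tower of height 5).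
   Formalization: In the definition of a hypercycle, consecutive nodes are additionally required to differ (v_t ≠ v_{t+1}); without this, v,e,v would be a hypercycle for every node v of a hyperedge e, and hyperforests would have no nonempty hyperedges. *)

theory Defs
  imports Complex_Main "HOL-Library.FuncSet"
begin

text \<open>
  The nodes of an instance are \<open>1, \<dots>, n\<close>. The (finite) set of hyperedges is given by an enumeration
  \<open>es\<close> without repetitions, so that the family of the sets \<open>e \<inter> [j]\<close>, for all hyperedges \<open>e\<close>, can be
  shown to an algorithm as a list: equal partial hyperedges are not merged, and the positions tell
  which partial hyperedges belong to the same \<open>e\<close> in different steps. The enumeration is arbitrary
  and part of the instance.
\<close>

definition hypergraph :: "nat \<Rightarrow> nat set list \<Rightarrow> bool" where
  "hypergraph n es \<longleftrightarrow> distinct es \<and> (\<forall>e \<in> set es. e \<subseteq> {1..n})"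

text \<open>
  The condition \<open>v t \<noteq> v (t + 1)\<close> excludes degenerate sequences; without it, \<open>v, e, v\<close> would be a
  hypercycle for every \<open>v \<in> e\<close>. In particular it forces \<open>l \<ge> 2\<close>.
\<close>

definition hypercycle :: "nat set set \<Rightarrow> nat \<Rightarrow> (nat \<Rightarrow> nat) \<Rightarrow> (nat \<Rightarrow> nat set) \<Rightarrow> bool" where
  "hypercycle E l v f \<longleftrightarrow>
     l \<ge> 1 \<and> v (l + 1) = v 1 \<and> inj_on f {1..l} \<and>
     (\<forall>t \<in> {1..l}. f t \<in> E \<and> v t \<in> f t \<and> v (t + 1) \<in> f t \<and> v t \<noteq> v (t + 1))"

definition hyperforest :: "nat set set \<Rightarrow> bool" where
  "hyperforest E \<longleftrightarrow> \<not> (\<exists>l v f. hypercycle E l v f)"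

text \<open>On \<open>nat\<close>, the supremum of a finite nonempty set is its maximum, and that of the empty set is 0.\<close>

definition makespan :: "nat \<Rightarrow> nat set set \<Rightarrow> (nat \<Rightarrow> nat) \<Rightarrow> nat" where
  "makespan m E c = (SUP i \<in> {1..m}. SUP e \<in> E. card (c -` {i} \<inter> e))"

definition opt_makespan :: "nat \<Rightarrow> nat \<Rightarrow> nat set set \<Rightarrow> nat" where
  "opt_makespan m n E = Min (makespan m E ` ({1..n} \<rightarrow>\<^sub>E {1..m}))"

text \<open>
  A deterministic online algorithm maps the revealed node \<open>j\<close> and the current partial hyperedges to a
  color. The partial hyperedges of earlier steps are the restrictions of the current ones, and the
  algorithm's own earlier choices are determined by these, so this is the whole history.
\<close>

type_synonym online_alg = "nat \<Rightarrow> nat set list \<Rightarrow> nat"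

definition online_algorithm :: "nat \<Rightarrow> online_alg \<Rightarrow> bool" where
  "online_algorithm m A \<longleftrightarrow> (\<forall>j ps. A j ps \<in> {1..m})"

definition online_coloring :: "online_alg \<Rightarrow> nat set list \<Rightarrow> nat \<Rightarrow> nat" where
  "online_coloring A es j = A j (map (\<lambda>e. e \<inter> {1..j}) es)"

definition competitive_on :: "(nat \<times> nat set list) set \<Rightarrow> nat \<Rightarrow> real \<Rightarrow> online_alg \<Rightarrow> bool" where
  "competitive_on C m r A \<longleftrightarrow>
     (\<forall>(n, es) \<in> C. real (makespan m (set es) (online_coloring A es))
                     \<le> r * real (opt_makespan m n (set es)))"

fun tower :: "nat \<Rightarrow> nat \<Rightarrow> nat" where
  "tower x 0 = 1"
| "tower x (Suc h) = x ^ tower x h"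

end

theory Submission
  imports Defs "HOL-Combinatorics.Transposition"
begin

text \<open>
  The adversary keeps a supply of monochromatic partial hyperedges in pairwise different components.
  Given sizes \<open>k a\<close> such that many of them have color \<open>a\<close> and size \<open>k a\<close>, for every color \<open>a\<close>,
  a new node is added to one hyperedge of each color; whichever color \<open>b\<close> it receives, a
  monochromatic hyperedge of color \<open>b\<close> and size \<open>k b + 1\<close> arises. Repeating this, by the pigeonhole
  principle, one size \<open>k b\<close> can be increased at the cost of dividing the supply by \<open>m + 1\<close>. After at
  most \<open>m * (m - 1) + 1\<close> rounds some \<open>k b\<close> equals \<open>m\<close>. As a new node only ever connects different
  components, the hypergraph is a hyperforest, and permuting the colors within the components before
  each connection yields an offline coloring in which every hyperedge is rainbow.
\<close>

section \<open>Families built by connecting components\<close>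

text \<open>
  The labels \<open>\<kappa>\<close> stand for the components induced on the nodes below \<open>w\<close>: the hyperedges through \<open>w\<close>
  come from different components.
\<close>

definition separates :: "(nat \<Rightarrow> nat set) \<Rightarrow> nat \<Rightarrow> (nat \<Rightarrow> nat) \<Rightarrow> bool" where
  "separates P w \<kappa> \<longleftrightarrow>
     (\<forall>i x y. x \<in> P i \<longrightarrow> y \<in> P i \<longrightarrow> x < w \<longrightarrow> y < w \<longrightarrow> \<kappa> x = \<kappa> y) \<and>
     (\<forall>i i' x y. i \<noteq> i' \<longrightarrow> w \<in> P i \<longrightarrow> w \<in> P i' \<longrightarrow> x \<in> P i \<longrightarrow> y \<in> P i' \<longrightarrow>
        x < w \<longrightarrow> y < w \<longrightarrow> \<kappa> x \<noteq> \<kappa> y)"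

lemma separatesD_same:
  "separates P w \<kappa> \<Longrightarrow> x \<in> P i \<Longrightarrow> y \<in> P i \<Longrightarrow> x < w \<Longrightarrow> y < w \<Longrightarrow> \<kappa> x = \<kappa> y"
  unfolding separates_def by blast

lemma separatesD_diff:
  "separates P w \<kappa> \<Longrightarrow> i \<noteq> i' \<Longrightarrow> w \<in> P i \<Longrightarrow> w \<in> P i' \<Longrightarrow> x \<in> P i \<Longrightarrow> y \<in> P i' \<Longrightarrow>
     x < w \<Longrightarrow> y < w \<Longrightarrow> \<kappa> x \<noteq> \<kappa> y"
  unfolding separates_def by metis

section \<open>Exclusion of hypercycles by way of a largest node\<close>

text \<open>Serves to bring a largest node of a hypercycle to the front. As \<open>v\<close> is
  unconstrained beyond \<open>l + 1\<close>, the closing value has to be set to \<open>v 2\<close>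
  explicitly.\<close>

lemma hypercycle_rotate:
  assumes "hypercycle E l v f"
  shows "hypercycle E l (\<lambda>t. if t \<le> l then v (t + 1) else v 2) (\<lambda>t. if t < l then f (t + 1) else f 1)"
    (is "hypercycle E l ?v ?f")
proof -
  have l: "l \<ge> 1" and vl: "v (l + 1) = v 1" and inj: "inj_on f {1..l}"
    and ed: "\<And>t. t \<in> {1..l} \<Longrightarrow> f t \<in> E \<and> v t \<in> f t \<and> v (t + 1) \<in> f t \<and> v t \<noteq> v (t + 1)"
    using assms unfolding hypercycle_def by auto
  have "inj_on ?f {1..l}"
  proof (rule inj_onI)
    fix s t assume st: "s \<in> {1..l}" "t \<in> {1..l}" "?f s = ?f t"
    have "(if s < l then s + 1 else 1) = (if t < l then t + 1 else 1)"
      by (rule inj_onD[OF inj]) (use st l in \<open>simp_all split: if_splits\<close>)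
    then show "s = t" using st by (auto split: if_splits)
  qed
  moreover have "?f t \<in> E \<and> ?v t \<in> ?f t \<and> ?v (t + 1) \<in> ?f t \<and> ?v t \<noteq> ?v (t + 1)"
    if "t \<in> {1..l}" for t
  proof (cases "t < l")
    case True
    then show ?thesis using ed[of "t + 1"] by auto
  next
    case False
    then have "t = l" using that by auto
    then show ?thesis using ed[of 1] l vl by (auto simp: numeral_2_eq_2)
  qed
  moreover have "?v (l + 1) = ?v 1" using l by (simp add: numeral_2_eq_2)
  ultimately show ?thesis using l unfolding hypercycle_def by blast
qed

text \<open>Between \<open>w\<close> and its first return, all nodes lie below \<open>w\<close> and
  consecutive ones share a hyperedge, so they carry one label. But the walk leaves and re-enters
  \<open>w\<close> by distinct hyperedges, whose older nodes carry different labels.\<close>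

lemma no_hypercycle_from_max:
  assumes sep: "separates P w \<kappa>" and cyc: "hypercycle (range P) l v f"
    and max: "\<And>t. t \<in> {1..l} \<Longrightarrow> v t \<le> w" and start: "v 1 = w"
  shows False
proof -
  have l: "l \<ge> 1" and vl: "v (l + 1) = v 1" and inj: "inj_on f {1..l}"
    and ed: "\<And>t. t \<in> {1..l} \<Longrightarrow> f t \<in> range P \<and> v t \<in> f t \<and> v (t + 1) \<in> f t \<and> v t \<noteq> v (t + 1)"
    using cyc unfolding hypercycle_def by auto
  \<comment> \<open>Nodes of a hypercycle may repeat, so the walk is cut at the first return to
    \<open>w\<close>, which happens at \<open>l + 1\<close> at the latest.\<close>
  define s where "s = (LEAST s. s \<ge> 2 \<and> v s = w)"
  have ex: "l + 1 \<ge> 2 \<and> v (l + 1) = w" using l vl start by simp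
  have s: "s \<ge> 2 \<and> v s = w" unfolding s_def by (rule LeastI[where P = "\<lambda>s. s \<ge> 2 \<and> v s = w", OF ex])
  have sl: "s \<le> l + 1" unfolding s_def by (rule Least_le[where P = "\<lambda>s. s \<ge> 2 \<and> v s = w", OF ex])
  have notw: "v t \<noteq> w" if "2 \<le> t" "t < s" for t
    using not_less_Least[of t "\<lambda>s. s \<ge> 2 \<and> v s = w"] that unfolding s_def by blast
  have s3: "s \<ge> 3"
  proof (rule ccontr)
    assume "\<not> s \<ge> 3"
    then have "s = 2" using s by simp
    then show False using ed[of 1] s start l by (auto simp: numeral_2_eq_2)
  qed
  have lt: "v t < w" if "2 \<le> t" "t < s" for t
    using notw[OF that] max[of t] that sl by fastforce
  have same: "\<kappa> (v t) = \<kappa> (v 2)" if "2 \<le> t" "t < s" for t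
    using that
  proof (induction t rule: nat_induct_at_least)
    case base
    show ?case ..
  next
    case (Suc t)
    obtain i where "f t = P i" using ed[of t] Suc sl by fastforce
    then have "v t \<in> P i" "v (Suc t) \<in> P i" using ed[of t] Suc sl by auto
    then have "\<kappa> (v (Suc t)) = \<kappa> (v t)"
      using separatesD_same[OF sep] lt Suc by (metis Suc_lessD le_Suc_eq)
    then show ?case using Suc by simp
  qed
  obtain i i' where i: "f 1 = P i" and i': "f (s - 1) = P i'"
    using ed[of 1] ed[of "s - 1"] l s3 sl by fastforce
  have "f 1 \<noteq> f (s - 1)"
    using inj_onD[OF inj, of 1 "s - 1"] s3 sl l by force
  then have "i \<noteq> i'" using i i' by auto
  moreover have "w \<in> P i" "v 2 \<in> P i"
    using ed[of 1] l i start by (auto simp: numeral_2_eq_2)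
  moreover have "w \<in> P i'" "v (s - 1) \<in> P i'"
    using ed[of "s - 1"] s3 sl i' s by force+
  ultimately have "\<kappa> (v 2) \<noteq> \<kappa> (v (s - 1))"
    using separatesD_diff[OF sep] lt[of 2] lt[of "s - 1"] s3 by simp
  then show False using same[of "s - 1"] s3 by force
qed

text \<open>Each rotation moves a chosen largest node one place towards the front; hence the
  induction on its position \<open>k\<close>.\<close>

lemma hyperforest_range:
  assumes sep: "\<And>w. \<exists>\<kappa>. separates P w \<kappa>"
  shows "hyperforest (range P)"
proof -
  have no: False
    if "hypercycle (range P) l v f" "\<And>t. t \<in> {1..l} \<Longrightarrow> v t \<le> w" "k \<in> {1..l}" "v k = w"
    for l v f w k
    using that
  proof (induction k arbitrary: v f)
    case 0
    then show ?case by simp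
  next
    case (Suc k)
    show ?case
    proof (cases "k = 0")
      case True
      obtain \<kappa> where "separates P w \<kappa>" using sep by blast
      then show False
        by (rule no_hypercycle_from_max[OF _ Suc.prems(1,2)]) (use Suc.prems(4) True in auto)
    next
      case False
      have "v (l + 1) = v 1" using Suc.prems(1) unfolding hypercycle_def by blast
      then have "(if t \<le> l then v (t + 1) else v 2) \<le> w" if "t \<in> {1..l}" for t
        using Suc.prems(2)[of "t + 1"] Suc.prems(2)[of 1] that by (cases "t = l") auto
      then show False
        by (rule Suc.IH[OF hypercycle_rotate[OF Suc.prems(1)]]) (use Suc.prems False in auto)
    qed
  qed
  show ?thesis
    unfolding hyperforest_def
  proof clarify
    fix l v f assume cyc: "hypercycle (range P) l v f"
    then have "l \<ge> 1" unfolding hypercycle_def by blast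
    then have "Max (v ` {1..l}) \<in> v ` {1..l}" by (intro Max_in) auto
    then obtain k where "k \<in> {1..l}" "v k = Max (v ` {1..l})" by auto
    then show False using no[OF cyc, of "Max (v ` {1..l})" k] by auto
  qed
qed

section \<open>Offline rainbow coloring\<close>

text \<open>For each label, at most one hyperedge through the new node \<open>w\<close> has older
  nodes with that label. It has fewer than \<open>m\<close> of them, so it misses a color. Swapping
  this color with 1 on the whole class of the label frees color 1 for \<open>w\<close>. The older
  part of any hyperedge lies in a single class, so it stays rainbow.\<close>

lemma rainbow_coloring:
  fixes P :: "nat \<Rightarrow> nat set"
  assumes m: "m \<ge> 1" and sep: "\<And>w. \<exists>\<kappa>. separates P w \<kappa>"
    and fin: "\<And>i. finite (P i)" and card: "\<And>i. card (P i) \<le> m"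
  shows "\<exists>c. (\<forall>x. c x \<in> {1..m}) \<and> (\<forall>i. inj_on c (P i \<inter> {..<n}))"
proof (induction n)
  case 0
  show ?case using m by (intro exI[of _ "\<lambda>_. 1"]) auto
next
  case (Suc w)
  then obtain c where c: "\<And>x. c x \<in> {1..m}" and inj: "\<And>i. inj_on c (P i \<inter> {..<w})" by blast
  obtain \<kappa> where \<kappa>: "separates P w \<kappa>" using sep by blast
  have free: "\<exists>b \<in> {1..m}. b \<notin> c ` (P i \<inter> {..<w})" if "w \<in> P i" for i
  proof (rule ccontr)
    assume "\<not> ?thesis"
    then have "{1..m} \<subseteq> c ` (P i \<inter> {..<w})" by blast
    then have "m \<le> card (c ` (P i \<inter> {..<w}))"
      using card_mono[of "c ` (P i \<inter> {..<w})" "{1..m}"] fin by simp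
    also have "\<dots> \<le> card (P i \<inter> {..<w})" using fin by (intro card_image_le) auto
    also have "\<dots> < card (P i)" using that fin by (intro psubset_card_mono) auto
    finally show False using card[of i] by simp
  qed
  have "\<exists>b. b \<in> {1..m} \<and>
      (\<forall>i x. w \<in> P i \<longrightarrow> x \<in> P i \<longrightarrow> x < w \<longrightarrow> \<kappa> x = a \<longrightarrow> b \<notin> c ` (P i \<inter> {..<w}))" for a
  proof (cases "\<exists>i x. w \<in> P i \<and> x \<in> P i \<and> x < w \<and> \<kappa> x = a")
    case True
    then obtain i x where ix: "w \<in> P i" "x \<in> P i" "x < w" "\<kappa> x = a" by blast
    obtain b where b: "b \<in> {1..m}" "b \<notin> c ` (P i \<inter> {..<w})" using free[OF ix(1)] by blast
    have "i' = i" if "w \<in> P i'" "y \<in> P i'" "y < w" "\<kappa> y = a" for i' y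
      using separatesD_diff[OF \<kappa>, of i' i y x] that ix by auto
    then show ?thesis using b by blast
  next
    case False
    \<comment> \<open>No hyperedge through \<open>w\<close> has an older node with this label; the
      default 1 turns the later transposition into the identity.\<close>
    then show ?thesis using m by (intro exI[of _ 1]) auto
  qed
  then obtain b where b: "\<And>a. b a \<in> {1..m}"
    and bfree: "\<And>i x. w \<in> P i \<Longrightarrow> x \<in> P i \<Longrightarrow> x < w \<Longrightarrow> b (\<kappa> x) \<notin> c ` (P i \<inter> {..<w})"
    by metis
  define c' where "c' x = (if x = w then 1 else transpose 1 (b (\<kappa> x)) (c x))" for x
  have "c' x \<in> {1..m}" for x
    using c[of x] b[of "\<kappa> x"] m unfolding c'_def transpose_def by auto
  moreover have "inj_on c' (P i \<inter> {..<Suc w})" for i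
  proof (rule inj_onI)
    fix x y assume xy: "x \<in> P i \<inter> {..<Suc w}" "y \<in> P i \<inter> {..<Suc w}" "c' x = c' y"
    have old: "c' z \<noteq> 1" if "w \<in> P i" "z \<in> P i" "z < w" for z
    \<comment> \<open>The transposition yields 1 only from the color \<open>b (\<kappa> z)\<close>,
      which the hyperedge avoids below \<open>w\<close>.\<close>
    proof -
      have "c z \<in> c ` (P i \<inter> {..<w})" using that by blast
      then have "c z \<noteq> b (\<kappa> z)" using bfree[OF that] by metis
      then show ?thesis using that unfolding c'_def transpose_def by auto
    qed
    have w1: "c' w = 1" unfolding c'_def by simp
    consider "x = w" "y = w" | "x = w" "y < w" | "x < w" "y = w" | "x < w" "y < w"
      using xy by fastforce
    then show "x = y"
    proof cases
      case 2
      then show ?thesis using old[of y] xy w1 by auto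
    next
      case 3
      then show ?thesis using old[of x] xy w1 by auto
    next
      case 4
      then have "\<kappa> x = \<kappa> y" using separatesD_same[OF \<kappa>] xy by blast
      then have "transpose 1 (b (\<kappa> x)) (c x) = transpose 1 (b (\<kappa> x)) (c y)"
        using xy(3) 4 unfolding c'_def by simp
      then have "c x = c y" by (metis transpose_involutory)
      then show ?thesis using inj_onD[OF inj, of x y i] 4 xy by auto
    qed simp
  qed
  ultimately show ?case by blast
qed

section \<open>The adversary\<close>

text \<open>
  Positions after \<open>j\<close> nodes: \<open>P i\<close> is the partial hyperedge opened by node \<open>i\<close> (so the number of
  hyperedges is fixed in advance and reveals nothing), \<open>\<kappa>\<close> labels the components, and \<open>L\<close> is a set of
  hyperedges in different components.
\<close>

definition position :: "nat \<Rightarrow> nat \<Rightarrow> (nat \<Rightarrow> nat set) \<Rightarrow> (nat \<Rightarrow> nat) \<Rightarrow> nat set \<Rightarrow> bool" where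
  "position m j P \<kappa> L \<longleftrightarrow>
     (\<forall>i. P i \<subseteq> {i..j}) \<and> P 0 = {} \<and> (\<forall>i \<in> {1..j}. i \<in> P i) \<and> (\<forall>i. card (P i) \<le> m) \<and>
     (\<forall>w. \<exists>\<kappa>'. separates P w \<kappa>') \<and> (\<forall>i. \<forall>x \<in> P i. \<kappa> x = \<kappa> i) \<and> (\<forall>x. \<kappa> x \<le> j) \<and>
     L \<subseteq> {1..j} \<and> inj_on \<kappa> L"

section \<open>Adding one node to a position\<close>

text \<open>Each node also opens a hyperedge of its own. In a position this makes \<open>i\<close>
  the least element of \<open>P i\<close> for every revealed \<open>i\<close>, so the final
  hyperedges are distinct, and it provides monochromatic hyperedges of size 1.\<close>

definition extend :: "nat \<Rightarrow> nat set \<Rightarrow> (nat \<Rightarrow> nat set) \<Rightarrow> nat \<Rightarrow> nat set" where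
  "extend j S P i = (if i \<in> insert (Suc j) S then insert (Suc j) (P i) else P i)"

text \<open>In a position after \<open>j\<close> nodes, unopened hyperedges are listed as empty
  sets, and only the colors of nodes up to \<open>j\<close> are final.\<close>

definition play :: "online_alg \<Rightarrow> nat \<Rightarrow> (nat \<Rightarrow> nat set) \<Rightarrow> nat \<Rightarrow> nat" where
  "play A N P = online_coloring A (map P [1..<Suc N])"

lemma play_extend:
  assumes "x \<le> j"
  shows "play A N (extend j S P) x = play A N P x"
proof -
  have "extend j S P i \<inter> {1..x} = P i \<inter> {1..x}" for i
    using assms unfolding extend_def by auto
  then show ?thesis unfolding play_def online_coloring_def by (simp add: comp_def)
qed

text \<open>The new node merges the components of the hyperedges in \<open>S\<close> into one. Of
  that component only one hyperedge \<open>r\<close> may stay in the supply, since the labels must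
  remain injective on it.\<close>

lemma position_extend:
  assumes pos: "position m j P \<kappa> L" and m: "m \<ge> 1" and S: "S \<subseteq> L"
    and small: "\<And>i. i \<in> S \<Longrightarrow> card (P i) < m" and r: "r \<in> insert (Suc j) S"
  shows "\<exists>\<kappa>'. position m (Suc j) (extend j S P) \<kappa>' (insert r (L - S))"
proof -
  have Psub: "\<And>i. P i \<subseteq> {i..j}" and P0: "P 0 = {}" and Pi: "\<And>i. i \<in> {1..j} \<Longrightarrow> i \<in> P i"
    and Pcard: "\<And>i. card (P i) \<le> m" and Psep: "\<And>w. \<exists>\<kappa>'. separates P w \<kappa>'"
    and \<kappa>: "\<And>i x. x \<in> P i \<Longrightarrow> \<kappa> x = \<kappa> i" and \<kappa>j: "\<And>x. \<kappa> x \<le> j"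
    and L: "L \<subseteq> {1..j}" and inj: "inj_on \<kappa> L"
    using pos unfolding position_def by auto
  let ?P = "extend j S P"
  have PS: "P (Suc j) = {}" using Psub[of "Suc j"] by auto
  have SL: "i \<in> {1..j}" if "i \<in> S" for i using that S L by blast
  have mem: "x \<in> ?P i \<longleftrightarrow> x \<in> P i \<or> (x = Suc j \<and> i \<in> insert (Suc j) S)" for x i
    unfolding extend_def by auto
  have old: "x \<le> j \<and> i \<le> x" if "x \<in> P i" for x i using Psub[of i] that by auto
  \<comment> \<open>The merged component receives the label \<open>Suc j\<close>, which is fresh
    because all old labels are at most \<open>j\<close>.\<close>
  define \<kappa>' where "\<kappa>' x = (if x \<le> j \<and> \<kappa> x \<notin> \<kappa> ` S then \<kappa> x else Suc j)" for x
  have const: "\<kappa>' x = \<kappa>' i" if "x \<in> ?P i" for x i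
  proof (cases "x \<in> P i")
    case True
    then have "x \<le> j" "i \<le> j" "\<kappa> x = \<kappa> i" using old[of x i] \<kappa> by auto
    then show ?thesis unfolding \<kappa>'_def by simp
  next
    case False
    then show ?thesis using that unfolding mem \<kappa>'_def by auto
  qed
  have sep: "\<exists>\<kappa>''. separates ?P w \<kappa>''" for w
  proof -
    \<comment> \<open>For \<open>w \<le> j\<close> nothing below or at \<open>w\<close> has changed.
      For the new node, \<open>\<kappa>\<close> itself works, as \<open>S\<close> has at most one
      hyperedge per component. Later nodes lie in no hyperedge yet.\<close>
    consider "w \<le> j" | "w = Suc j" | "w > Suc j" by linarith
    then show ?thesis
    proof cases
      case 1
      obtain \<kappa>'' where k: "separates P w \<kappa>''" using Psep by blast
      have "x \<in> ?P i \<longleftrightarrow> x \<in> P i" if "x \<le> w" for x i using that 1 unfolding mem by auto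
      then have "separates ?P w \<kappa>''"
        using k unfolding separates_def by (metis less_imp_le order_refl)
      then show ?thesis by blast
    next
      case 2
      have "\<kappa> x \<noteq> \<kappa> y"
        if "i \<noteq> i'" "w \<in> ?P i" "w \<in> ?P i'" "x \<in> ?P i" "y \<in> ?P i'" "x < w" "y < w" for i i' x y
      proof -
        have xy: "x \<in> P i" "y \<in> P i'" using that 2 unfolding mem by auto
        moreover have "i \<in> S" "i' \<in> S"
          using that 2 xy old[of w i] old[of w i'] PS unfolding mem by auto
        ultimately show ?thesis using \<kappa> inj_onD[OF inj, of i i'] that(1) S by auto
      qed
      moreover have "\<kappa> x = \<kappa> y" if "x \<in> ?P i" "y \<in> ?P i" "x < w" "y < w" for i x y
        using that 2 \<kappa>[of x i] \<kappa>[of y i] unfolding mem by auto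
      ultimately have "separates ?P w \<kappa>" unfolding separates_def by blast
      then show ?thesis by blast
    next
      case 3
      then have "w \<notin> ?P i" for i using old[of w i] unfolding mem by auto
      then have "separates ?P w \<kappa>'" unfolding separates_def using const by metis
      then show ?thesis by blast
    qed
  qed
  have cardS: "card (?P i) \<le> m" for i
  proof -
    have "finite (P i)" using Psub[of i] finite_subset by blast
    then have "card (?P i) \<le> Suc (card (P i))" unfolding extend_def by (simp add: card_insert_if)
    moreover have "card (?P (Suc j)) = 1" unfolding extend_def PS by simp
    ultimately show ?thesis using small[of i] Pcard[of i] m unfolding extend_def
      by (cases "i = Suc j"; cases "i \<in> S") auto
  qed
  have notr: "\<kappa>' x = \<kappa> x" if "x \<in> L - S" for x
  proof -
    have "\<kappa> x \<notin> \<kappa> ` S" using inj_onD[OF inj, of x] that S by blast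
    then show ?thesis using that L unfolding \<kappa>'_def by auto
  qed
  have "\<kappa>' r = Suc j" using r unfolding \<kappa>'_def by auto
  then have inj': "inj_on \<kappa>' (insert r (L - S))"
    using notr \<kappa>j inj unfolding inj_on_def
    by (metis DiffD1 Suc_n_not_le_n insertE)
  have "\<kappa>' x \<le> Suc j" for x using \<kappa>j[of x] unfolding \<kappa>'_def by auto
  moreover have "?P i \<subseteq> {i..Suc j}" for i
    using Psub[of i] SL[of i] unfolding extend_def by auto
  moreover have "?P 0 = {}" using SL[of 0] P0 unfolding extend_def by auto
  moreover have "i \<in> ?P i" if "i \<in> {1..Suc j}" for i
    using Pi[of i] that unfolding extend_def by (cases "i = Suc j") auto
  moreover have "insert r (L - S) \<subseteq> {1..Suc j}" using r L S by auto
  ultimately have "position m (Suc j) ?P \<kappa>' (insert r (L - S))"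
    using sep cardS const inj' unfolding position_def by blast
  then show ?thesis by blast
qed

lemma online_algorithm_colors: "online_algorithm m A \<Longrightarrow> m \<ge> 1"
  unfolding online_algorithm_def by (meson atLeastAtMost_iff order_trans)

section \<open>Growth of the monochromatic supply\<close>

definition mono_edges ::
    "(nat \<Rightarrow> nat) \<Rightarrow> (nat \<Rightarrow> nat set) \<Rightarrow> nat set \<Rightarrow> nat \<Rightarrow> nat \<Rightarrow> nat set" where
  "mono_edges c P L a s = {i \<in> L. card (P i) = s \<and> (\<forall>x \<in> P i. c x = a)}"

lemma finite_mono_edges:
  "position m j P \<kappa> L \<Longrightarrow> finite (mono_edges c P L a s)"
  by (rule finite_subset[of _ "{1..j}"]) (auto simp: position_def mono_edges_def)

text \<open>The new node joins one hyperedge of size \<open>k a\<close> for each color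
  \<open>a\<close> with \<open>k a \<ge> 1\<close>. All of these are given up except the one whose
  color the node receives. A color with \<open>k a = 0\<close> requires no stock, because the
  hyperedge opened by the node takes that role.\<close>

lemma adversary_step:
  fixes k :: "nat \<Rightarrow> nat"
  assumes alg: "online_algorithm m A" and pos: "position m j P \<kappa> L"
    and k: "\<And>a. a \<in> {1..m} \<Longrightarrow> k a < m"
    and stock: "\<And>a. a \<in> {1..m} \<Longrightarrow> k a \<ge> 1 \<Longrightarrow> card (mono_edges (play A N P) P L a (k a)) \<ge> 1"
  shows "\<exists>P' \<kappa>' L'. position m (Suc j) P' \<kappa>' L' \<and>
    (\<forall>a \<in> {1..m}. k a \<ge> 1 \<longrightarrow> card (mono_edges (play A N P') P' L' a (k a)) \<ge>
       card (mono_edges (play A N P) P L a (k a)) - 1) \<and>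
    (\<Sum>a\<in>{1..m}. card (mono_edges (play A N P') P' L' a (k a + 1))) \<ge>
      Suc (\<Sum>a\<in>{1..m}. card (mono_edges (play A N P) P L a (k a + 1)))"
proof -
  let ?c = "play A N P"
  let ?M = "mono_edges ?c P L"
  have m: "m \<ge> 1" using online_algorithm_colors[OF alg] .
  have Psub: "\<And>i. P i \<subseteq> {i..j}" and Pi: "\<And>i. i \<in> {1..j} \<Longrightarrow> i \<in> P i" and L: "L \<subseteq> {1..j}"
    using pos unfolding position_def by auto
  have "\<exists>i. i \<in> ?M a (k a)" if "a \<in> {1..m}" "k a \<ge> 1" for a
    using stock[OF that] by (metis card.empty equals0I not_one_le_zero)
  then obtain s where s: "\<And>a. a \<in> {1..m} \<Longrightarrow> k a \<ge> 1 \<Longrightarrow> s a \<in> ?M a (k a)" by metis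
  define S where "S = s ` {a \<in> {1..m}. k a \<ge> 1}"
  have SL: "S \<subseteq> L" using s unfolding S_def mono_edges_def by auto
  let ?P = "extend j S P"
  let ?c' = "play A N ?P"
  define b where "b = ?c' (Suc j)"
  have b: "b \<in> {1..m}"
    using alg unfolding b_def play_def online_coloring_def online_algorithm_def by blast
  \<comment> \<open>The hyperedge that becomes monochromatic of size \<open>k b + 1\<close>: the
    enlarged one, or for \<open>k b = 0\<close> the singleton of the new node.\<close>
  define r where "r = (if k b \<ge> 1 then s b else Suc j)"
  have small: "card (P i) < m" if "i \<in> S" for i
    using that s k unfolding S_def mono_edges_def by auto
  have rS: "r \<in> insert (Suc j) S" using b unfolding r_def S_def by auto
  define L' where "L' = insert r (L - S)"
  obtain \<kappa>' where pos': "position m (Suc j) ?P \<kappa>' L'"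
    using position_extend[OF pos m SL small rS] unfolding L'_def by blast
  let ?M' = "mono_edges ?c' ?P L'"
  have keep: "?M a t - S \<subseteq> ?M' a t" for a t
  proof
    fix i assume i: "i \<in> ?M a t - S"
    then have "i \<noteq> Suc j" using L unfolding mono_edges_def by auto
    then have "?P i = P i" using i unfolding extend_def by auto
    moreover have "?c' x = ?c x" if "x \<in> P i" for x
      using that Psub[of i] by (intro play_extend) auto
    ultimately show "i \<in> ?M' a t" using i unfolding mono_edges_def L'_def by auto
  qed
  have color: "a' = a" if "i \<in> ?M a t" "i \<in> ?M a' t'" for i a a' t t'
  proof -
    have "i \<in> P i" using that Pi[of i] L unfolding mono_edges_def by blast
    then show ?thesis using that unfolding mono_edges_def by auto
  qed
  have rM: "r \<in> ?M' b (k b + 1)"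
  proof (cases "k b \<ge> 1")
    case True
    then have sb: "s b \<in> ?M b (k b)" "s b \<in> S" using s b unfolding S_def by auto
    have "finite (P (s b))" "Suc j \<notin> P (s b)" using Psub[of "s b"] finite_subset by auto
    moreover have "?c' x = ?c x" if "x \<in> P (s b)" for x
      using that Psub[of "s b"] by (intro play_extend) auto
    moreover have "?P (s b) = insert (Suc j) (P (s b))" using sb unfolding extend_def by simp
    ultimately show ?thesis
      using sb True b_def unfolding r_def mono_edges_def L'_def by auto
  next
    case False
    have "P (Suc j) = {}" using Psub[of "Suc j"] by auto
    then show ?thesis using False unfolding r_def mono_edges_def L'_def
      by (auto simp: b_def extend_def)
  qed
  have rnew: "r \<notin> ?M b (k b + 1)"
    using s[of b] b L unfolding r_def mono_edges_def by auto
  \<comment> \<open>A used hyperedge of color \<open>a\<close> has size \<open>k a\<close>, so no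
    hyperedge counted at the next size is lost.\<close>
  have disj: "?M a (k a + 1) \<inter> S = {}" if "a \<in> {1..m}" for a
  proof (rule ccontr)
    assume "\<not> ?thesis"
    then obtain a' where a': "a' \<in> {1..m}" "k a' \<ge> 1" "s a' \<in> ?M a (k a + 1)"
      unfolding S_def by auto
    then have "a' = a" using color s by blast
    then show False using a' s[of a'] unfolding mono_edges_def by auto
  qed
  have "card (?M' a (k a)) \<ge> card (?M a (k a)) - 1" if "a \<in> {1..m}" "k a \<ge> 1" for a
  proof -
    have "?M a (k a) \<inter> S \<subseteq> {s a}"
      using color s unfolding S_def by blast
    then have "?M a (k a) - {s a} \<subseteq> ?M' a (k a)" using keep by blast
    then have "card (?M a (k a) - {s a}) \<le> card (?M' a (k a))"
      by (rule card_mono[OF finite_mono_edges[OF pos']])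
    then show ?thesis using s[OF that] by (simp add: card_Diff_singleton)
  qed
  moreover have "Suc (\<Sum>a\<in>{1..m}. card (?M a (k a + 1))) \<le> (\<Sum>a\<in>{1..m}. card (?M' a (k a + 1)))"
  proof -
    have "card (?M a (k a + 1)) \<le> card (?M' a (k a + 1))" if "a \<in> {1..m}" for a
      using keep disj[OF that] by (intro card_mono[OF finite_mono_edges[OF pos']]) blast
    moreover have "card (?M b (k b + 1)) < card (?M' b (k b + 1))"
      using keep disj[OF b] rM rnew
      by (intro psubset_card_mono[OF finite_mono_edges[OF pos']]) blast
    ultimately show ?thesis using b by (intro Suc_leI sum_strict_mono_ex1) auto
  qed
  ultimately show ?thesis using pos' by blast
qed

text \<open>The sizes \<open>k\<close> stay fixed for the whole round, so the \<open>T\<close> steps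
  add up: each costs at most one hyperedge per color and gains at least one at the next
  sizes.\<close>

lemma adversary_round:
  fixes k :: "nat \<Rightarrow> nat"
  assumes alg: "online_algorithm m A"
    and k: "\<And>a. a \<in> {1..m} \<Longrightarrow> k a < m"
    and pos: "position m j P \<kappa> L"
    and stock: "\<And>a. a \<in> {1..m} \<Longrightarrow> k a \<ge> 1 \<Longrightarrow> card (mono_edges (play A N P) P L a (k a)) \<ge> X + T"
  shows "\<exists>P' \<kappa>' L'. position m (j + T) P' \<kappa>' L' \<and>
    (\<forall>a \<in> {1..m}. k a \<ge> 1 \<longrightarrow> card (mono_edges (play A N P') P' L' a (k a)) \<ge> X) \<and>
    (\<Sum>a\<in>{1..m}. card (mono_edges (play A N P') P' L' a (k a + 1))) \<ge>
      T + (\<Sum>a\<in>{1..m}. card (mono_edges (play A N P) P L a (k a + 1)))"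
  using pos stock
proof (induction T arbitrary: j P \<kappa> L)
  case 0
  then show ?case by (intro exI[of _ P] exI[of _ \<kappa>] exI[of _ L]) auto
next
  case (Suc T)
  have "1 \<le> card (mono_edges (play A N P) P L a (k a))" if "a \<in> {1..m}" "k a \<ge> 1" for a
    using Suc.prems(2)[OF that] by simp
  from adversary_step[OF alg Suc.prems(1) k this]
  obtain P' \<kappa>' L' where pos': "position m (Suc j) P' \<kappa>' L'"
    and dec: "\<And>a. a \<in> {1..m} \<Longrightarrow> k a \<ge> 1 \<Longrightarrow> card (mono_edges (play A N P') P' L' a (k a)) \<ge>
       card (mono_edges (play A N P) P L a (k a)) - 1"
    and inc: "(\<Sum>a\<in>{1..m}. card (mono_edges (play A N P') P' L' a (k a + 1))) \<ge>
      Suc (\<Sum>a\<in>{1..m}. card (mono_edges (play A N P) P L a (k a + 1)))"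
    by blast
  have "card (mono_edges (play A N P') P' L' a (k a)) \<ge> X + T" if "a \<in> {1..m}" "k a \<ge> 1" for a
    using dec[OF that] Suc.prems(2)[OF that] by simp
  from Suc.IH[OF pos' this]
  obtain P'' \<kappa>'' L'' where "position m (Suc j + T) P'' \<kappa>'' L''"
    "\<forall>a \<in> {1..m}. k a \<ge> 1 \<longrightarrow> card (mono_edges (play A N P'') P'' L'' a (k a)) \<ge> X"
    "(\<Sum>a\<in>{1..m}. card (mono_edges (play A N P'') P'' L'' a (k a + 1))) \<ge>
      T + (\<Sum>a\<in>{1..m}. card (mono_edges (play A N P') P' L' a (k a + 1)))"
    by blast
  with inc show ?case
    by (intro exI[of _ P''] exI[of _ \<kappa>''] exI[of _ L'']) auto
qed

text \<open>Every round that does not finish raises one \<open>k b\<close> by 1 and uses up one of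
  the \<open>s\<close> rounds, so \<open>s + (\<Sum>a\<in>{1..m}. k a)\<close> is preserved. With
  all sizes below \<open>m\<close> the sum is at most \<open>m * (m - 1)\<close>, so a size
  \<open>m\<close> is reached before \<open>s\<close> is exhausted.\<close>

lemma adversary_wins:
  fixes k :: "nat \<Rightarrow> nat"
  assumes alg: "online_algorithm m A"
    and pos: "position m j P \<kappa> L"
    and k: "\<And>a. a \<in> {1..m} \<Longrightarrow> k a < m"
    and stock: "\<And>a. a \<in> {1..m} \<Longrightarrow> k a \<ge> 1 \<Longrightarrow>
      card (mono_edges (play A N P) P L a (k a)) \<ge> (m + 1) ^ s"
    and rounds: "s + (\<Sum>a\<in>{1..m}. k a) > m * (m - 1)"
    and room: "j + (m + 1) ^ s \<le> N"
  shows "\<exists>j' P' \<kappa>' L' a. j' \<le> N \<and> a \<in> {1..m} \<and> position m j' P' \<kappa>' L' \<and>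
    mono_edges (play A N P') P' L' a m \<noteq> {}"
  using pos k stock rounds room
proof (induction s arbitrary: j P \<kappa> L k)
  case 0
  have "(\<Sum>a\<in>{1..m}. k a) \<le> (\<Sum>a\<in>{1..m}. m - 1)"
  proof (rule sum_mono)
    fix a assume "a \<in> {1..m}"
    then show "k a \<le> m - 1" using 0(2)[of a] by linarith
  qed
  then show ?case using 0(4) by simp
next
  case (Suc s)
  \<comment> \<open>A round of \<open>m * X\<close> nodes leaves \<open>X\<close> of the old stock
    per color and creates at least \<open>m * X\<close> larger hyperedges, hence \<open>X\<close> of
    them in some color.\<close>
  define X where "X = (m + 1) ^ s"
  have X: "(m + 1) ^ Suc s = X + m * X" "X \<ge> 1" unfolding X_def by (simp_all add: algebra_simps)
  have "X + m * X \<le> card (mono_edges (play A N P) P L a (k a))" if "a \<in> {1..m}" "k a \<ge> 1" for a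
    using Suc.prems(3)[OF that] unfolding X .
  from adversary_round[OF alg Suc.prems(2) Suc.prems(1) this]
  obtain P' \<kappa>' L' where pos': "position m (j + m * X) P' \<kappa>' L'"
    and sup: "\<And>a. a \<in> {1..m} \<Longrightarrow> k a \<ge> 1 \<Longrightarrow> card (mono_edges (play A N P') P' L' a (k a)) \<ge> X"
    and sum: "(\<Sum>a\<in>{1..m}. card (mono_edges (play A N P') P' L' a (k a + 1))) \<ge> m * X"
    using add_leD1 by blast
  have m: "m \<ge> 1" using online_algorithm_colors[OF alg] .
  obtain b where b: "b \<in> {1..m}" "card (mono_edges (play A N P') P' L' b (k b + 1)) \<ge> X"
  proof (rule ccontr)
    note that' = that
    assume "\<not> thesis"
    then have "card (mono_edges (play A N P') P' L' a (k a + 1)) < X" if "a \<in> {1..m}" for a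
      using that' that by (meson not_le)
    then have "(\<Sum>a\<in>{1..m}. card (mono_edges (play A N P') P' L' a (k a + 1))) < (\<Sum>a\<in>{1..m}. X)"
      using m by (intro sum_strict_mono) auto
    then show False using sum by simp
  qed
  show ?case
  proof (cases "k b + 1 = m")
    case True
    then have "mono_edges (play A N P') P' L' b m \<noteq> {}" using b X by auto
    moreover have "j + m * X \<le> N" using Suc.prems(5) unfolding X by simp
    ultimately show ?thesis using b(1) pos' by blast
  next
    case False
    show ?thesis
    proof (rule Suc.IH[OF pos', where k = "k(b := k b + 1)"])
      show "(k(b := k b + 1)) a < m" if "a \<in> {1..m}" for a
        using False Suc.prems(2)[OF that] by auto
      show "(m + 1) ^ s \<le> card (mono_edges (play A N P') P' L' a ((k(b := k b + 1)) a))"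
        if "a \<in> {1..m}" "1 \<le> (k(b := k b + 1)) a" for a
        using sup[of a] b that unfolding X_def[symmetric] by auto
      have "(\<Sum>a\<in>{1..m}. (k(b := k b + 1)) a) = Suc (\<Sum>a\<in>{1..m}. k a)"
        using b(1) by (simp add: sum.remove[of _ b])
      then show "m * (m - 1) < s + (\<Sum>a\<in>{1..m}. (k(b := k b + 1)) a)" using Suc.prems(4) by simp
      show "j + m * X + (m + 1) ^ s \<le> N" using Suc.prems(5) unfolding X X_def[symmetric] by simp
    qed
  qed
qed

text \<open>The game may end early, while the instance must have exactly \<open>N\<close> nodes. The
  missing ones are added with \<open>S = {}\<close>, each only in its own singleton
  hyperedge.\<close>

lemma fill_position:
  assumes m: "m \<ge> 1" and pos: "position m j P \<kappa> L" and "mono_edges (play A N P) P L a t \<noteq> {}"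
  shows "\<exists>P' \<kappa>' L'. position m (j + d) P' \<kappa>' L' \<and> mono_edges (play A N P') P' L' a t \<noteq> {}"
proof (induction d)
  case 0
  then show ?case using assms by auto
next
  case (Suc d)
  then obtain P' \<kappa>' L' i where pos': "position m (j + d) P' \<kappa>' L'"
    and i: "i \<in> mono_edges (play A N P') P' L' a t" by blast
  obtain \<kappa>'' where
    "position m (Suc (j + d)) (extend (j + d) {} P') \<kappa>'' (insert (Suc (j + d)) (L' - {}))"
    using position_extend[OF pos' m] by blast
  moreover have "i \<noteq> Suc (j + d)" "P' i \<subseteq> {i..j + d}"
    using pos' i unfolding position_def mono_edges_def by auto
  then have "i \<in> mono_edges (play A N (extend (j + d) {} P')) (extend (j + d) {} P')
      (insert (Suc (j + d)) (L' - {})) a t"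
    using i play_extend[of _ "j + d" A N "{}" P'] unfolding mono_edges_def
    by (auto simp: extend_def subset_iff)
  ultimately show ?case by auto
qed

lemma adversary_instance:
  assumes alg: "online_algorithm m A" and N: "N = (m + 1) ^ (m * (m - 1) + 1)"
  obtains P \<kappa> L a where "a \<in> {1..m}" "position m N P \<kappa> L" "mono_edges (play A N P) P L a m \<noteq> {}"
proof -
  have m: "m \<ge> 1" using online_algorithm_colors[OF alg] .
  have pos0: "position m 0 (\<lambda>_. {}) (\<lambda>_. 0) {}"
    unfolding position_def separates_def by auto
  obtain j P \<kappa> L a where j: "j \<le> N" and a: "a \<in> {1..m}" and pos: "position m j P \<kappa> L"
    and mono: "mono_edges (play A N P) P L a m \<noteq> {}"
    \<comment> \<open>All sizes start at 0, so the empty position meets the stock condition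
      vacuously.\<close>
    using adversary_wins[OF alg pos0, where k = "\<lambda>_. 0" and N = N and s = "m * (m - 1) + 1"] m N
    by fastforce
  from fill_position[OF m pos mono, of "N - j"] j a that show thesis by fastforce
qed

section \<open>Makespans\<close>

lemma makespan_ge:
  assumes "finite E" "e \<in> E" "i \<in> {1..m}"
  shows "card (c -` {i} \<inter> e) \<le> makespan m E c"
proof -
  have "card (c -` {i} \<inter> e) \<le> (SUP e \<in> E. card (c -` {i} \<inter> e))"
    using assms by (intro cSUP_upper bdd_above_finite) auto
  also have "\<dots> \<le> makespan m E c"
    unfolding makespan_def using assms by (intro cSUP_upper bdd_above_finite) auto
  finally show ?thesis .
qed

lemma makespan_le_1:
  assumes "m \<ge> 1" "E \<noteq> {}" "\<And>e. e \<in> E \<Longrightarrow> finite e \<and> inj_on c e"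
  shows "makespan m E c \<le> 1"
  unfolding makespan_def
proof (intro cSUP_least)
  fix i e assume "e \<in> E"
  then have "inj_on c e" using assms by blast
  then have "\<forall>x \<in> c -` {i} \<inter> e. \<forall>y \<in> c -` {i} \<inter> e. x = y" by (auto dest: inj_onD)
  then show "card (c -` {i} \<inter> e) \<le> 1"
    using \<open>e \<in> E\<close> assms(3) by (metis One_nat_def card_le_Suc0_iff_eq finite_Int)
qed (use assms in auto)

lemma opt_makespan_le_1:
  assumes m: "m \<ge> 1" and E: "E \<noteq> {}" "\<And>e. e \<in> E \<Longrightarrow> e \<subseteq> {1..n}"
    and c: "\<And>x. c x \<in> {1..m}" "\<And>e. e \<in> E \<Longrightarrow> inj_on c e"
  shows "opt_makespan m n E \<le> 1"
proof -
  let ?c = "restrict c {1..n}"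
  have "opt_makespan m n E \<le> makespan m E ?c"
    unfolding opt_makespan_def
    by (intro Min_le finite_imageI finite_PiE imageI restrict_PiE_iff[THEN iffD2]) (use c in auto)
  also have "\<dots> \<le> 1"
  proof (rule makespan_le_1[OF m E(1)])
    fix e assume "e \<in> E"
    then have "e \<subseteq> {1..n}" "inj_on c e" using E c by auto
    then show "finite e \<and> inj_on ?c e"
      using finite_subset[of e "{1..n}"] by (auto simp: inj_on_def subset_iff)
  qed
  finally show ?thesis .
qed

text \<open>Distinctness comes from \<open>i\<close> being the least element of \<open>P i\<close>;
  the separating labels yield both the absence of hypercycles and the rainbow coloring that bounds
  the optimum.\<close>

lemma position_instance:
  assumes m: "m \<ge> 1" and pos: "position m N P \<kappa> L" and N: "N \<ge> 1"
  defines "es \<equiv> map P [1..<Suc N]"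
  shows "hypergraph N es" "hyperforest (set es)" "\<forall>e \<in> set es. card e \<le> m"
    "opt_makespan m N (set es) \<le> 1"
proof -
  have Psub: "\<And>i. P i \<subseteq> {i..N}" and Pi: "\<And>i. i \<in> {1..N} \<Longrightarrow> i \<in> P i"
    and Pcard: "\<And>i. card (P i) \<le> m" and Psep: "\<And>w. \<exists>\<kappa>'. separates P w \<kappa>'"
    using pos unfolding position_def by auto
  have es: "set es = P ` {1..N}" unfolding es_def by auto
  have sub: "e \<subseteq> {1..N}" if "e \<in> set es" for e
    using that Psub unfolding es by fastforce
  have "inj_on P {1..N}"
  proof (rule inj_onI)
    fix i i' assume "i \<in> {1..N}" "i' \<in> {1..N}" "P i = P i'"
    then have "i \<in> P i'" "i' \<in> P i" using Pi by auto
    then show "i = i'" using Psub[of i] Psub[of i'] by fastforce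
  qed
  moreover have "set [1..<Suc N] = {1..N}" by auto
  ultimately have "distinct es" unfolding es_def by (simp only: distinct_map distinct_upt simp_thms)
  then show "hypergraph N es" using sub unfolding hypergraph_def by blast
  have "hyperforest (range P)" using hyperforest_range Psep by blast
  moreover have "set es \<subseteq> range P" unfolding es by blast
  ultimately show "hyperforest (set es)" unfolding hyperforest_def hypercycle_def by blast
  show "\<forall>e \<in> set es. card e \<le> m" using Pcard unfolding es by auto
  have "\<And>i. finite (P i)" using Psub finite_subset by blast
  then obtain c where c: "\<And>x. c x \<in> {1..m}" "\<And>i. inj_on c (P i \<inter> {..<Suc N})"
    using rainbow_coloring[OF m Psep _ Pcard] by blast
  have "P i \<inter> {..<Suc N} = P i" for i using Psub[of i] by auto
  then have "inj_on c e" if "e \<in> set es" for e using c(2) that unfolding es by (metis imageE)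
  moreover have "set es \<noteq> {}" using N unfolding es by auto
  ultimately show "opt_makespan m N (set es) \<le> 1" using opt_makespan_le_1 m sub c(1) by blast
qed

section \<open>The bound on the number of nodes\<close>

text \<open>A very generous estimate: the exponent is already at most \<open>x ^ 2\<close>, and
  \<open>n \<le> x ^ n\<close> climbs the remaining levels of the tower.\<close>

lemma adversary_size_le_tower:
  assumes "m \<ge> 1"
  shows "(m + 1) ^ (m * (m - 1) + 1) \<le> tower (2 * m + 1) 5"
proof -
  define x where "x = 2 * m + 1"
  have x: "x \<ge> 2" "m \<le> x" using assms unfolding x_def by auto
  have le: "n \<le> x ^ n" for n using x(1) by (rule self_le_ge2_pow)
  have "m * (m - 1) + 1 \<le> m * (m - 1) + m" using assms by simp
  also have "\<dots> = m * m" using assms by (cases m) auto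
  also have "\<dots> \<le> x * x" using x by (intro mult_mono) auto
  also have "\<dots> = x ^ 2" by (simp only: power2_eq_square)
  also have "\<dots> \<le> x ^ x" using x by (intro power_increasing) auto
  also have "\<dots> \<le> x ^ (x ^ x)" by (rule le)
  also have "\<dots> \<le> x ^ (x ^ (x ^ x))" by (rule le)
  also have "\<dots> = tower x 4" by (simp add: eval_nat_numeral)
  finally have "x ^ (m * (m - 1) + 1) \<le> x ^ tower x 4"
    using x by (intro power_increasing) auto
  moreover have "(m + 1) ^ (m * (m - 1) + 1) \<le> x ^ (m * (m - 1) + 1)"
    unfolding x_def by (intro power_mono) auto
  moreover have "tower x 5 = x ^ tower x 4" by (simp add: eval_nat_numeral)
  ultimately show ?thesis unfolding x_def by linarith
qed

theorem mainTheorem11: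
  fixes m :: nat
  assumes "m \<ge> 1"
  shows "\<exists>N. N \<le> tower (2 * m + 1) 5 \<and>
           (\<forall>\<epsilon>::real. \<epsilon> > 0 \<longrightarrow>
              \<not> (\<exists>A. online_algorithm m A \<and>
                     competitive_on
                       {(n, es). n = N \<and> hypergraph n es \<and> hyperforest (set es) \<and>
                                 (\<forall>e \<in> set es. card e \<le> m)}
                       m (real m - \<epsilon>) A))"
proof -
  define N where "N = (m + 1) ^ (m * (m - 1) + 1)"
  have N1: "N \<ge> 1" unfolding N_def by (rule one_le_power) simp
  have False if \<epsilon>: "\<epsilon> > 0" and alg: "online_algorithm m A" and comp: "competitive_on
      {(n, es). n = N \<and> hypergraph n es \<and> hyperforest (set es) \<and> (\<forall>e \<in> set es. card e \<le> m)}
      m (real m - \<epsilon>) A" for \<epsilon> :: real and A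
  proof -
    obtain P \<kappa> L a where a: "a \<in> {1..m}" and pos: "position m N P \<kappa> L"
      and mono: "mono_edges (play A N P) P L a m \<noteq> {}"
      by (rule adversary_instance[OF alg N_def])
    let ?es = "map P [1..<Suc N]"
    note inst = position_instance[OF assms pos N1]
    obtain i where i: "i \<in> L" "card (P i) = m" "\<And>x. x \<in> P i \<Longrightarrow> play A N P x = a"
      using mono unfolding mono_edges_def by blast
    have "i \<in> {1..N}" using i pos unfolding position_def by blast
    then have "P i \<in> set ?es" unfolding set_map by (intro imageI) auto
    then have "card (online_coloring A ?es -` {a} \<inter> P i) \<le>
        makespan m (set ?es) (online_coloring A ?es)"
      by (intro makespan_ge a finite_set)
    moreover have "online_coloring A ?es -` {a} \<inter> P i = P i"
      using i(3) unfolding play_def by blast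
    ultimately have "real m \<le> real (makespan m (set ?es) (online_coloring A ?es))"
      using i(2) by simp
    also have "\<dots> \<le> (real m - \<epsilon>) * real (opt_makespan m N (set ?es))"
      using comp inst(1-3) unfolding competitive_on_def by blast
    finally have le: "real m \<le> (real m - \<epsilon>) * real (opt_makespan m N (set ?es))" .
    \<comment> \<open>The factor \<open>real m - \<epsilon>\<close> may be negative, so the bound on
      the optimum is not inserted by monotonicity; both possible values are treated.\<close>
    have "opt_makespan m N (set ?es) = 0 \<or> opt_makespan m N (set ?es) = 1"
      using inst(4) by linarith
    then show False using le \<epsilon> assms by auto
  qed
  then show ?thesis using adversary_size_le_tower[OF assms] unfolding N_def by blast
qed

end
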